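(* Let $a$ be an integer with $a\notin\{0,1,-1\}$, and let $p$ be an odd prime with $p\nmid 3a(2-a)(a^3+1)$. Let $\{u_n\}_{n\geq0}$ be defined by $u_0=0$, $u_1=1$, $u_{n+1}=(2-a)u_n-(a^2-a+1)u_{n-1}$ for $n\geq1$. Then, if $p\equiv1\pmod3$, $$\frac{u_{p-1}}{p}\equiv\frac{2}{3a^2}\sum_{k=1}^{\frac{p-1}{3}}\frac{(-a)^{3k}}{k}+\frac{1}{3a^2}\Big((2-a)q_p(a^2-a+1)+2(a+1)q_p(a+1)\Big)\pmod p;$$ and if $p\equiv2\pmod3$, $$\frac{u_{p+1}}{p}\equiv-\frac{2(a^2-a+1)}{3a^2}\sum_{k=1}^{\frac{p-2}{3}}\frac{(-a)^{3k}}{k}-\frac{a^2-a+1}{3a^2}\Big((2-a)q_p(a^2-a+1)+2(a+1)q_p(a+1)\Big)\pmod p.$$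
   Context: For an odd prime $p$ and an integer $x$ with $p\nmid x$, $q_p(x)=\frac{x^{p-1}-1}{p}$. Congruences modulo $p$ between rationals with denominators prime to $p$ are understood in the ring of $p$-integral rationals. *)

theory Defs
  imports Complex_Main "HOL-Number_Theory.Number_Theory"
begin

definition fermat_quotient :: "nat \<Rightarrow> int \<Rightarrow> rat" where
  "fermat_quotient p x = (rat_of_int x ^ (p - 1) - 1) / rat_of_nat p"

(* quotient_of yields the reduced fraction with positive denominator *)
definition p_integral :: "nat \<Rightarrow> rat \<Rightarrow> bool" where
  "p_integral p r \<longleftrightarrow> coprime (snd (quotient_of r)) (int p)"

text \<open>
  Congruence modulo \<open>p\<close> in the ring of \<open>p\<close>-integral rationals. Membership of both sides in
  that ring is part of the relation, so a congruence for \<open>x / p\<close> with \<open>x\<close> an integer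
  includes the claim that \<open>p\<close> divides \<open>x\<close>.
\<close>

definition rat_cong :: "nat \<Rightarrow> rat \<Rightarrow> rat \<Rightarrow> bool" where
  "rat_cong p x y \<longleftrightarrow> p_integral p x \<and> p_integral p y \<and>
     (\<exists>z. p_integral p z \<and> x - y = rat_of_nat p * z)"

end

theory Submission
  imports Defs
begin

text \<open>
  The characteristic roots of \<open>u\<close> are \<open>1 + a \<omega>\<close> and \<open>1 + a \<omega>\<^sup>2\<close> for a primitive cube root of
  unity \<open>\<omega>\<close>, so everything is governed by the trisections \<open>R\<^sub>j\<close> of \<open>(1 + a)\<^sup>n\<close> by the
  residue of the exponent mod 3: one has \<open>a u\<^sub>n = R\<^sub>1 - R\<^sub>2\<close>, \<open>(1 + a)\<^sup>n = R\<^sub>0 + R\<^sub>1 + R\<^sub>2\<close>, and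
  \<open>(a\<^sup>2 - a + 1)\<^sup>n\<close> is the norm of \<open>R\<^sub>0 + R\<^sub>1 \<omega> + R\<^sub>2 \<omega>\<^sup>2\<close>. For \<open>n = p\<close> the \<open>R\<^sub>j\<close> are
  \<open>1, a, 0\<close> in some order modulo \<open>p\<close>; expanding to first order in \<open>p\<close> expresses \<open>u\<^sub>p\<^sub>\<plusminus>\<^sub>1 / p\<close>,
  \<open>q\<^sub>p(1 + a)\<close> and \<open>q\<^sub>p(a\<^sup>2 - a + 1)\<close> linearly in the three error terms. Eliminating two of them
  leaves that of \<open>R\<^sub>0\<close>, which is the sum over \<open>k\<close> because
  \<open>3 k (p choose 3 k) / p = (p - 1 choose 3 k - 1) \<equiv> (-1)\<^bsup>3 k - 1\<^esup>\<close> modulo \<open>p\<close>.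
\<close>

subsection \<open>\<open>p\<close>-integral rationals\<close>

text \<open>The reduced denominator divides every other denominator of the same number, so any
  fraction may serve as witness; the closure lemmas below rely on this freedom.\<close>

lemma p_integral_iff:
  assumes "prime p"
  shows "p_integral p r \<longleftrightarrow> (\<exists>m n. \<not> int p dvd n \<and> r = rat_of_int m / rat_of_int n)"
proof
  assume "p_integral p r"
  then have "coprime (snd (quotient_of r)) (int p)"
    by (simp add: p_integral_def)
  then have "\<not> int p dvd snd (quotient_of r)"
    using assms coprime_common_divisor_int[of _ "int p" "int p"] prime_gt_1_nat[of p] by auto
  moreover have "r = rat_of_int (fst (quotient_of r)) / rat_of_int (snd (quotient_of r))"
    by (metis prod.collapse quotient_of_div)
  ultimately show "\<exists>m n. \<not> int p dvd n \<and> r = rat_of_int m / rat_of_int n"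
    by blast
next
  assume "\<exists>m n. \<not> int p dvd n \<and> r = rat_of_int m / rat_of_int n"
  then obtain m n where n: "\<not> int p dvd n" and r: "r = rat_of_int m / rat_of_int n"
    by blast
  obtain c d where cd: "quotient_of r = (c, d)"
    by fastforce
  have d: "d > 0" "coprime c d" "r = rat_of_int c / rat_of_int d"
    using cd quotient_of_denom_pos quotient_of_coprime quotient_of_div by blast+
  have "n \<noteq> 0"
    using n by auto
  have "rat_of_int (m * d) = rat_of_int (c * n)"
    using r d \<open>n \<noteq> 0\<close> by (simp add: field_simps)
  then have "m * d = c * n"
    by (simp only: of_int_eq_iff)
  then have "d dvd n"
    using d(2) by (metis coprime_commute coprime_dvd_mult_right_iff dvd_triv_right)
  then have "\<not> int p dvd d"
    using n dvd_trans by blast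
  then show "p_integral p r"
    using assms cd unfolding p_integral_def
    by (simp add: coprime_commute[of d] prime_imp_coprime)
qed

lemma p_integral_divide:
  assumes "prime p" "p_integral p x" "\<not> int p dvd n"
  shows "p_integral p (x / rat_of_int n)"
proof -
  obtain c d where "\<not> int p dvd d" "x = rat_of_int c / rat_of_int d"
    using assms by (auto simp: p_integral_iff)
  then have "\<not> int p dvd d * n" "x / rat_of_int n = rat_of_int c / rat_of_int (d * n)"
    using assms by (auto simp: prime_dvd_mult_iff)
  then show ?thesis
    using assms(1) p_integral_iff by blast
qed

lemma p_integral_of_int: "p_integral p (rat_of_int m)"
  by (simp add: p_integral_def)

lemma p_integral_add:
  assumes "prime p" "p_integral p x" "p_integral p y"
  shows "p_integral p (x + y)"
proof -
  obtain m n c d where *: "\<not> int p dvd n" "x = rat_of_int m / rat_of_int n"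
    "\<not> int p dvd d" "y = rat_of_int c / rat_of_int d"
    using assms by (auto simp: p_integral_iff)
  then have "n \<noteq> 0" "d \<noteq> 0"
    by auto
  then have "\<not> int p dvd n * d" "x + y = rat_of_int (m * d + c * n) / rat_of_int (n * d)"
    using * assms by (auto simp: prime_dvd_mult_iff field_simps)
  then show ?thesis
    using assms(1) p_integral_iff by blast
qed

lemma p_integral_mult:
  assumes "prime p" "p_integral p x" "p_integral p y"
  shows "p_integral p (x * y)"
proof -
  obtain m n c d where *: "\<not> int p dvd n" "x = rat_of_int m / rat_of_int n"
    "\<not> int p dvd d" "y = rat_of_int c / rat_of_int d"
    using assms by (auto simp: p_integral_iff)
  then have "\<not> int p dvd n * d" "x * y = rat_of_int (m * c) / rat_of_int (n * d)"
    using assms by (auto simp: prime_dvd_mult_iff)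
  then show ?thesis
    using assms(1) p_integral_iff by blast
qed

lemma p_integral_minus: "p_integral p x \<Longrightarrow> p_integral p (- x)"
  by (simp add: p_integral_def rat_uminus_code split_beta Let_def)

lemma p_integral_sum:
  assumes "prime p" "\<And>k. k \<in> A \<Longrightarrow> p_integral p (f k)"
  shows "p_integral p (sum f A)"
  using assms(2)
proof (induction A rule: infinite_finite_induct)
  case (insert x F)
  then show ?case
    using assms(1) by (simp add: p_integral_add)
qed (use p_integral_of_int[of p 0] in auto)

subsection \<open>Trisection of the binomial expansion\<close>

definition trisect :: "nat \<Rightarrow> int \<Rightarrow> nat \<Rightarrow> int" where
  "trisect j a n = (\<Sum>k\<le>n. of_bool (k mod 3 = j) * int (n choose k) * a ^ k)"

text \<open>Pascal's rule under an arbitrary weight: the second summand sees the weight shifted by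
  one index, which permutes the indicators of residue classes cyclically.\<close>

lemma weighted_binomial_sum_Suc:
  fixes a :: "'a :: comm_ring_1"
  shows "(\<Sum>k\<le>Suc n. w k * of_nat (Suc n choose k) * a ^ k) =
    (\<Sum>k\<le>n. w k * of_nat (n choose k) * a ^ k) + a * (\<Sum>k\<le>n. w (Suc k) * of_nat (n choose k) * a ^ k)"
proof -
  have "(\<Sum>k\<le>n. w k * of_nat (n choose k) * a ^ k) =
      (\<Sum>k\<le>Suc n. w k * of_nat (n choose k) * a ^ k)"
    by (simp add: binomial_eq_0)
  also have "\<dots> = w 0 + (\<Sum>k\<le>n. w (Suc k) * of_nat (n choose Suc k) * a ^ Suc k)"
    by (subst sum.atMost_Suc_shift) simp
  finally show ?thesis
    by (subst sum.atMost_Suc_shift) (simp add: algebra_simps sum.distrib sum_distrib_left)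
qed

lemma trisect_0:
  "trisect 0 a 0 = 1" "trisect 1 a 0 = 0" "trisect 2 a 0 = 0"
  by (simp_all add: trisect_def)

lemma trisect_Suc:
  "trisect 0 a (Suc n) = trisect 0 a n + a * trisect 2 a n"
  "trisect 1 a (Suc n) = trisect 1 a n + a * trisect 0 a n"
  "trisect 2 a (Suc n) = trisect 2 a n + a * trisect 1 a n"
proof -
  have "Suc k mod 3 = 0 \<longleftrightarrow> k mod 3 = 2" "Suc k mod 3 = 1 \<longleftrightarrow> k mod 3 = 0"
    "Suc k mod 3 = 2 \<longleftrightarrow> k mod 3 = 1" for k
    by presburger+
  then show
    "trisect 0 a (Suc n) = trisect 0 a n + a * trisect 2 a n"
    "trisect 1 a (Suc n) = trisect 1 a n + a * trisect 0 a n"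
    "trisect 2 a (Suc n) = trisect 2 a n + a * trisect 1 a n"
    unfolding trisect_def weighted_binomial_sum_Suc by simp_all
qed

lemma trisect_sum: "trisect 0 a n + trisect 1 a n + trisect 2 a n = (a + 1) ^ n"
proof (induction n)
  case (Suc n)
  have "trisect 0 a (Suc n) + trisect 1 a (Suc n) + trisect 2 a (Suc n)
      = (a + 1) * (trisect 0 a n + trisect 1 a n + trisect 2 a n)"
    unfolding trisect_Suc by Groebner_Basis.algebra
  then show ?case
    using Suc by simp
qed (simp add: trisect_0 del: One_nat_def)

text \<open>The norm form of \<open>x + y * \<omega> + z * \<omega>\<^sup>2\<close>, symmetric in
  its three arguments.\<close>

definition norm3 :: "int \<Rightarrow> int \<Rightarrow> int \<Rightarrow> int" where
  "norm3 x y z = x ^ 2 + y ^ 2 + z ^ 2 - x * y - y * z - x * z"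

text \<open>The trisections are coefficients of \<open>(1 + a * \<omega>) ^ n\<close>; by
  multiplicativity each step contributes the norm of \<open>1 + a * \<omega>\<close>.\<close>

lemma trisect_norm:
  "norm3 (trisect 0 a n) (trisect 1 a n) (trisect 2 a n) = (a ^ 2 - a + 1) ^ n"
proof (induction n)
  case (Suc n)
  have "norm3 (trisect 0 a (Suc n)) (trisect 1 a (Suc n)) (trisect 2 a (Suc n))
      = (a ^ 2 - a + 1) * norm3 (trisect 0 a n) (trisect 1 a n) (trisect 2 a n)"
    unfolding trisect_Suc norm3_def by Groebner_Basis.algebra
  then show ?case
    using Suc by simp
qed (simp add: trisect_0 norm3_def del: One_nat_def)

text \<open>The characteristic roots differ by \<open>a * (\<omega> - \<omega>\<^sup>2)\<close>;
  keeping the factor \<open>a\<close> on the left avoids dividing by it.\<close>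

lemma lucas_eq_trisect:
  fixes u :: "nat \<Rightarrow> int"
  assumes "u 0 = 0" "u 1 = 1"
    and rec: "\<And>n. n \<ge> 1 \<Longrightarrow> u (n + 1) = (2 - a) * u n - (a ^ 2 - a + 1) * u (n - 1)"
  shows "a * u n = trisect 1 a n - trisect 2 a n"
proof -
  \<comment> \<open>The recurrence has order two, so the induction carries two consecutive
    indices.\<close>
  have "a * u n = trisect 1 a n - trisect 2 a n \<and>
    a * u (Suc n) = trisect 1 a (Suc n) - trisect 2 a (Suc n)"
  proof (induction n)
    case 0
    then show ?case
      using assms(1,2) trisect_0[of a] trisect_Suc[of a 0] by simp
  next
    case (Suc n)
    have "u (Suc (Suc n)) = (2 - a) * u (Suc n) - (a ^ 2 - a + 1) * u n"
      using rec[of "Suc n"] by simp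
    then have "a * u (Suc (Suc n)) = (2 - a) * (a * u (Suc n)) - (a ^ 2 - a + 1) * (a * u n)"
      by Groebner_Basis.algebra
    also have "\<dots> = trisect 1 a (Suc (Suc n)) - trisect 2 a (Suc (Suc n))"
      using Suc unfolding trisect_Suc by Groebner_Basis.algebra
    finally show ?case
      using Suc by simp
  qed
  then show ?thesis ..
qed

subsection \<open>Prime exponents\<close>

text \<open>Neighbours in row \<open>p - 1\<close> add up to an inner entry of row \<open>p\<close>,
  a multiple of \<open>p\<close>, so the entries alternate in sign modulo \<open>p\<close>.\<close>

lemma prime_binomial_minus_one_cong:
  assumes "prime p" "j < p"
  shows "[int (p - 1 choose j) = (-1) ^ j] (mod int p)"
  using assms(2)
proof (induction j)
  case (Suc j)
  have "(p - 1 choose j) + (p - 1 choose Suc j) = p choose Suc j"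
    using assms(1) by (metis Suc_pred' binomial_Suc_Suc prime_gt_0_nat)
  moreover have "p dvd p choose Suc j"
    using Suc assms(1) by (intro dvd_choose_prime) auto
  ultimately have "[int (p - 1 choose j) + int (p - 1 choose Suc j) = 0] (mod int p)"
    by (metis cong_0_iff int_dvd_int_iff of_nat_add)
  from cong_diff[OF this Suc.IH] show ?case
    using Suc by simp
qed simp

text \<open>Only the end terms \<open>k = 0\<close> and \<open>k = p\<close> survive modulo
  \<open>p\<close>, and the latter is reduced by Fermat's little theorem.\<close>

lemma trisect_prime_cong:
  assumes "prime p"
  shows "[trisect j a p = of_bool (j = 0) + of_bool (p mod 3 = j) * a] (mod int p)"
proof -
  have "p > 0"
    using assms prime_gt_0_nat by blast
  then have set: "{..p} = insert 0 (insert p {1..<p})"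
    by auto
  have "[(\<Sum>k\<in>{1..<p}. of_bool (k mod 3 = j) * int (p choose k) * a ^ k) = 0] (mod int p)"
    unfolding cong_0_iff
    by (intro dvd_sum dvd_mult dvd_mult2) (use assms dvd_choose_prime in auto)
  moreover have "trisect j a p = of_bool (j = 0) + of_bool (p mod 3 = j) * a ^ p
      + (\<Sum>k\<in>{1..<p}. of_bool (k mod 3 = j) * int (p choose k) * a ^ k)"
    unfolding trisect_def set using \<open>p > 0\<close> by (subst sum.insert; simp)+
  moreover have "[a ^ p = a] (mod int p)"
  proof (cases "int p dvd a")
    case True
    then have "int p dvd a ^ p"
      using \<open>p > 0\<close> by (meson dvd_power dvd_trans)
    then show ?thesis
      using True by (simp add: cong_iff_dvd_diff)
  next
    case False
    then have "coprime a (int p)"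
      using assms by (simp add: coprime_commute[of a] prime_imp_coprime)
    moreover have "residues (int p)"
      using assms prime_gt_1_nat[of p] by (simp add: residues_def)
    ultimately have "[a ^ (p - 1) = 1] (mod int p)"
      using residues.euler_theorem[of "int p" a] assms by (simp add: totient_prime)
    then have "[a * a ^ (p - 1) = a * 1] (mod int p)"
      by (rule cong_scalar_left)
    then show ?thesis
      using \<open>p > 0\<close> by (simp add: power_eq_if)
  qed
  ultimately show ?thesis
    by (metis (no_types, lifting) add.right_neutral cong_add cong_refl cong_scalar_left)
qed

lemma trisect_0_eq:
  "trisect 0 a p = 1 + (\<Sum>k = 1..p div 3. int (p choose (3 * k)) * a ^ (3 * k))"
proof -
  have "trisect 0 a p = (\<Sum>k | k \<le> p \<and> k mod 3 = 0. int (p choose k) * a ^ k)"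
    unfolding trisect_def by (rule sum.mono_neutral_cong_right) auto
  also have "\<dots> = (\<Sum>k = 0..p div 3. int (p choose (3 * k)) * a ^ (3 * k))"
    by (rule sum.reindex_bij_witness[of _ "\<lambda>k. 3 * k" "\<lambda>k. k div 3"]) auto
  also have "\<dots> = 1 + (\<Sum>k = 1..p div 3. int (p choose (3 * k)) * a ^ (3 * k))"
    by (simp add: sum.atLeast_Suc_atMost)
  finally show ?thesis .
qed

text \<open>\<open>C\<close> is the sum of the binomial terms divided by \<open>p\<close>; the
  comparison is made term by term, with errors whose denominators \<open>k\<close> are prime to
  \<open>p\<close>.\<close>

lemma trisect_0_quotient:
  assumes "prime p" "p \<noteq> 3" and C: "trisect 0 a p = 1 + int p * C"
  obtains Z where "p_integral p Z"
    "(\<Sum>k = 1..p div 3. (- rat_of_int a) ^ (3 * k) / rat_of_nat k) = - 3 * rat_of_int C + rat_of_nat p * Z"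
proof -
  have "p > 0"
    using assms prime_gt_0_nat by blast
  have "\<exists>z. p_integral p z \<and> (- rat_of_int a) ^ (3 * k) / rat_of_nat k
      = - 3 * (rat_of_int (int (p choose (3 * k)) * a ^ (3 * k)) / rat_of_nat p) + rat_of_nat p * z"
    if k: "k \<in> {1..p div 3}" for k
  proof -
    have "3 * k \<noteq> p"
      using assms(1,2) by (metis dvd_triv_left numeral_eq_one_iff prime_nat_iff semiring_norm(86))
    then have k': "0 < k" "3 * k < p"
      using k by auto
    have "[int (p - 1 choose (3 * k - 1)) = (-1) ^ (3 * k - 1)] (mod int p)"
      using k' assms by (intro prime_binomial_minus_one_cong) auto
    then obtain m where m: "int (p - 1 choose (3 * k - 1)) = (-1) ^ (3 * k - 1) + int p * m"
      by (metis cong_iff_lin cong_sym)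
    \<comment> \<open>The exponent is raised to \<open>3 * k\<close> to match the sign in
      \<open>(- a) ^ (3 * k)\<close>; \<open>k > 0\<close> makes the subtraction genuine.\<close>
    have "(-1::int) ^ (3 * k) = - ((-1) ^ (3 * k - 1))"
      using k' by (subst power_eq_if) auto
    then have m': "int (p - 1 choose (3 * k - 1)) = int p * m - (-1) ^ (3 * k)"
      using m by simp
    \<comment> \<open>Absorption trades division by \<open>p\<close> for division by
      \<open>k\<close>.\<close>
    have "3 * k * (p choose (3 * k)) = p * (p - 1 choose (3 * k - 1))"
      using k' times_binomial_minus1_eq[of "3 * k" p] by simp
    then have "int (3 * k * (p choose (3 * k))) = int p * int (p - 1 choose (3 * k - 1))"
      by (metis of_nat_mult)
    then have "3 * int k * int (p choose (3 * k)) = int p * (int p * m - (-1) ^ (3 * k))"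
      unfolding m' by simp
    then have "rat_of_int (3 * int k * int (p choose (3 * k)))
        = rat_of_int (int p * (int p * m - (-1) ^ (3 * k)))"
      by (rule arg_cong)
    then have eq: "3 * rat_of_nat k * rat_of_nat (p choose (3 * k))
        = rat_of_nat p * (rat_of_nat p * rat_of_int m - (-1) ^ (3 * k))"
      by simp
    have "\<not> int p dvd int k"
      using k' by (auto dest: zdvd_imp_le)
    then have "p_integral p (rat_of_int (m * a ^ (3 * k)) / rat_of_int (int k))"
      using assms p_integral_divide p_integral_of_int by blast
    moreover have "(- rat_of_int a) ^ (3 * k) / rat_of_nat k
      = - 3 * (rat_of_int (int (p choose (3 * k)) * a ^ (3 * k)) / rat_of_nat p)
        + rat_of_nat p * (rat_of_int (m * a ^ (3 * k)) / rat_of_int (int k))"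
    proof -
      have "(- rat_of_int a) ^ (3 * k) = (-1) ^ (3 * k) * rat_of_int a ^ (3 * k)"
        by (rule power_minus)
      moreover have frac: "3 * rat_of_nat (p choose (3 * k)) / rat_of_nat p
          = (rat_of_nat p * rat_of_int m - (-1) ^ (3 * k)) / rat_of_nat k"
        using eq \<open>p > 0\<close> k' by (simp add: field_simps)
      have "- 3 * (rat_of_int (int (p choose (3 * k)) * a ^ (3 * k)) / rat_of_nat p)
          = - ((rat_of_nat p * rat_of_int m - (-1) ^ (3 * k)) / rat_of_nat k) * rat_of_int a ^ (3 * k)"
        unfolding frac[symmetric] by simp
      ultimately show ?thesis
        using k' by (simp add: field_simps)
    qed
    ultimately show ?thesis
      by blast
  qed
  then obtain z where z: "\<And>k. k \<in> {1..p div 3} \<Longrightarrow> p_integral p (z k)"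
    "\<And>k. k \<in> {1..p div 3} \<Longrightarrow> (- rat_of_int a) ^ (3 * k) / rat_of_nat k
      = - 3 * (rat_of_int (int (p choose (3 * k)) * a ^ (3 * k)) / rat_of_nat p) + rat_of_nat p * z k"
    by metis
  have "int p * C = (\<Sum>k = 1..p div 3. int (p choose (3 * k)) * a ^ (3 * k))"
    using C trisect_0_eq[of a p] by simp
  then have "rat_of_int (int p * C) = rat_of_int (\<Sum>k = 1..p div 3. int (p choose (3 * k)) * a ^ (3 * k))"
    by (rule arg_cong)
  then have C': "rat_of_int C = (\<Sum>k = 1..p div 3. rat_of_int (int (p choose (3 * k)) * a ^ (3 * k)) / rat_of_nat p)"
    using \<open>p > 0\<close> by (simp add: field_simps flip: sum_divide_distrib)
  have "(\<Sum>k = 1..p div 3. (- rat_of_int a) ^ (3 * k) / rat_of_nat k)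
    = (\<Sum>k = 1..p div 3. - 3 * (rat_of_int (int (p choose (3 * k)) * a ^ (3 * k)) / rat_of_nat p) + rat_of_nat p * z k)"
    by (rule sum.cong) (simp_all only: z)
  also have "\<dots> = - 3 * rat_of_int C + rat_of_nat p * (\<Sum>k = 1..p div 3. z k)"
    unfolding C' by (simp only: sum.distrib flip: sum_distrib_left)
  finally show ?thesis
    using that p_integral_sum[OF assms(1), of "{1..p div 3}" z] z(1) by blast
qed

section \<open>Fermat quotients and first-order elimination\<close>

lemma fermat_quotient_eqI:
  assumes "p > 0" "x ^ p = x + int p * y"
  shows "rat_of_int x * fermat_quotient p x = rat_of_int y"
proof -
  have "rat_of_int (x ^ p) = rat_of_int (x + int p * y)"
    using assms by simp
  then have "rat_of_int x ^ p = rat_of_int x + rat_of_nat p * rat_of_int y"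
    by simp
  \<comment> \<open>Multiplying by \<open>x\<close> raises the exponent to \<open>p\<close>, where
    the trisections are known.\<close>
  moreover have "rat_of_int x ^ p = rat_of_int x * rat_of_int x ^ (p - 1)"
    using assms by (simp add: power_eq_if)
  ultimately show ?thesis
    using assms by (simp add: fermat_quotient_def field_simps)
qed

text \<open>
  Here \<open>C\<close>, \<open>D\<close>, \<open>E\<close> are the first-order terms of the trisections of \<open>(1 + a)\<^sup>p\<close> that are
  congruent to \<open>1\<close>, \<open>a\<close>, \<open>0\<close>; the norm form is symmetric, so both classes of \<open>p\<close> mod 3 lead to
  the same elimination.
\<close>

lemma fermat_quotients_elimination:
  assumes p: "prime p" "p \<noteq> 3"
    and N: "N = a ^ 2 - a + 1"
    and ndvd: "\<not> int p dvd 3 * a ^ 2 * N"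
    and C: "trisect 0 a p = 1 + int p * C"
    and pow: "(a + 1) ^ p = a + 1 + int p * (C + D + E)"
    and norm: "N ^ p = norm3 (1 + int p * C) (a + int p * D) (int p * E)"
  obtains z where "p_integral p z"
    "rat_of_int (D - (1 - a) * E - a * C) / rat_of_int (a * N) =
      2 / (3 * rat_of_int a ^ 2) * (\<Sum>k = 1..p div 3. (- rat_of_int a) ^ (3 * k) / rat_of_nat k)
      + 1 / (3 * rat_of_int a ^ 2) * (rat_of_int (2 - a) * fermat_quotient p N
                 + 2 * rat_of_int (a + 1) * fermat_quotient p (a + 1)) + rat_of_nat p * z"
proof -
  have p0: "p > 0"
    using p prime_gt_0_nat by blast
  have nz: "rat_of_int a \<noteq> 0" "rat_of_int N \<noteq> 0"
    using ndvd by auto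
  obtain Z where Z: "p_integral p Z"
    "(\<Sum>k = 1..p div 3. (- rat_of_int a) ^ (3 * k) / rat_of_nat k) = - 3 * rat_of_int C + rat_of_nat p * Z"
    using trisect_0_quotient[OF p C] .
  \<comment> \<open>\<open>L\<close> is the derivative of \<open>norm3\<close> at
    \<open>(1, a, 0)\<close> in direction \<open>(C, D, E)\<close>; the value there is
    \<open>N\<close>, and the quadratic remainder is \<open>norm3 C D E\<close>.\<close>
  define L where "L = (2 - a) * C + (2 * a - 1) * D - (a + 1) * E"
  have q1: "rat_of_int (a + 1) * fermat_quotient p (a + 1) = rat_of_int (C + D + E)"
    using p0 pow by (intro fermat_quotient_eqI) auto
  have "N ^ p = N + int p * (L + int p * norm3 C D E)"
    unfolding norm unfolding norm3_def L_def N by Groebner_Basis.algebra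
  from fermat_quotient_eqI[OF p0 this]
  have q2: "fermat_quotient p N = rat_of_int (L + int p * norm3 C D E) / rat_of_int N"
    using nz by (simp add: field_simps)
  \<comment> \<open>\<open>z\<close> cancels the two leftover multiples of \<open>p\<close>: the one
    with \<open>Z\<close> and the quadratic part of the norm.\<close>
  define z where "z = - (rat_of_int (2 * N) * Z + rat_of_int ((2 - a) * norm3 C D E)) / rat_of_int (3 * a ^ 2 * N)"
  have z: "p_integral p z"
    unfolding z_def using Z(1) p ndvd
    by (intro p_integral_divide p_integral_minus p_integral_add p_integral_mult p_integral_of_int)
  \<comment> \<open>The weights \<open>2 - a\<close> and \<open>2 * N\<close> are those of the two
    Fermat quotients after clearing \<open>N\<close>; they reproduce the \<open>D\<close> and
    \<open>E\<close> terms, and the multiple of \<open>C\<close> corrects the rest.\<close>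
  have "3 * a * (D - (1 - a) * E - a * C) = - 6 * N * C + (2 - a) * L + 2 * N * (C + D + E)"
    unfolding L_def N by Groebner_Basis.algebra
  then have "rat_of_int (3 * a * (D - (1 - a) * E - a * C)) = rat_of_int (- 6 * N * C + (2 - a) * L + 2 * N * (C + D + E))"
    by (rule arg_cong)
  then have key: "3 * rat_of_int a * rat_of_int (D - (1 - a) * E - a * C)
      = - 6 * rat_of_int N * rat_of_int C + rat_of_int (2 - a) * rat_of_int L
        + 2 * rat_of_int N * rat_of_int (C + D + E)"
    by (simp only: of_int_mult of_int_add of_int_numeral of_int_minus)
  have "rat_of_int (D - (1 - a) * E - a * C) / rat_of_int (a * N) =
      3 * rat_of_int a * rat_of_int (D - (1 - a) * E - a * C) / (3 * rat_of_int a ^ 2 * rat_of_int N)"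
    using nz by (simp add: field_simps power2_eq_square)
  also have "\<dots> = 2 / (3 * rat_of_int a ^ 2) * (- 3 * rat_of_int C + rat_of_nat p * Z)
      + 1 / (3 * rat_of_int a ^ 2) * (rat_of_int (2 - a) * fermat_quotient p N
                 + 2 * (rat_of_int (C + D + E))) + rat_of_nat p * z"
    unfolding key q2 z_def of_int_mult[of 2 N] of_int_mult[of "3 * a ^ 2"] of_int_mult[of "2 - a" "norm3 C D E"]
      of_int_add[of L] of_int_mult[of "int p"] of_int_of_nat_eq
    using nz by (simp add: divide_simps) (simp add: algebra_simps)
  finally have "rat_of_int (D - (1 - a) * E - a * C) / rat_of_int (a * N) =
      2 / (3 * rat_of_int a ^ 2) * (\<Sum>k = 1..p div 3. (- rat_of_int a) ^ (3 * k) / rat_of_nat k)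
      + 1 / (3 * rat_of_int a ^ 2) * (rat_of_int (2 - a) * fermat_quotient p N
                 + 2 * rat_of_int (a + 1) * fermat_quotient p (a + 1)) + rat_of_nat p * z"
    unfolding Z(2) mult.assoc[of 2 "rat_of_int (a + 1)"] q1 .
  with z show ?thesis
    by (rule that)
qed

text \<open>Integrality of \<open>y\<close> is inherited from \<open>x\<close> and \<open>z\<close>,
  so the long right-hand sides need no separate check.\<close>

lemma rat_congI:
  assumes "prime p" "p_integral p x" "p_integral p z" "x = y + rat_of_nat p * z"
  shows "rat_cong p x y"
proof -
  have "y = x + rat_of_int (int p) * (- z)"
    using assms by simp
  then have "p_integral p y"
    using assms p_integral_add p_integral_mult p_integral_minus p_integral_of_int by metis
  then show ?thesis
    using assms unfolding rat_cong_def by (metis add_diff_cancel_left')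
qed

section \<open>The two residue classes of \<open>p\<close> modulo 3\<close>

theorem theorem4p10:
  fixes a :: int and p :: nat and u :: "nat \<Rightarrow> int"
  assumes "a \<notin> {0, 1, -1}"
    and "prime p" and "odd p"
    and "\<not> int p dvd 3 * a * (2 - a) * (a ^ 3 + 1)"
    and "u 0 = 0" and "u 1 = 1"
    and "\<And>n. n \<ge> 1 \<Longrightarrow> u (n + 1) = (2 - a) * u n - (a ^ 2 - a + 1) * u (n - 1)"
  shows "([p = 1] (mod 3) \<longrightarrow>
           rat_cong p (rat_of_int (u (p - 1)) / rat_of_nat p)
             (2 / (3 * rat_of_int a ^ 2) *
                (\<Sum>k = 1..(p - 1) div 3. (- rat_of_int a) ^ (3 * k) / rat_of_nat k)
              + 1 / (3 * rat_of_int a ^ 2) *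
                (rat_of_int (2 - a) * fermat_quotient p (a ^ 2 - a + 1)
                 + 2 * rat_of_int (a + 1) * fermat_quotient p (a + 1)))) \<and>
         ([p = 2] (mod 3) \<longrightarrow>
           rat_cong p (rat_of_int (u (p + 1)) / rat_of_nat p)
             (- (2 * rat_of_int (a ^ 2 - a + 1) / (3 * rat_of_int a ^ 2)) *
                (\<Sum>k = 1..(p - 2) div 3. (- rat_of_int a) ^ (3 * k) / rat_of_nat k)
              - rat_of_int (a ^ 2 - a + 1) / (3 * rat_of_int a ^ 2) *
                (rat_of_int (2 - a) * fermat_quotient p (a ^ 2 - a + 1)
                 + 2 * rat_of_int (a + 1) * fermat_quotient p (a + 1))))"
proof -
  define N where "N = a ^ 2 - a + 1"
  have p0: "p > 0"
    using assms(2) prime_gt_0_nat by blast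
  have cube: "a ^ 3 + 1 = (a + 1) * N"
    unfolding N_def by Groebner_Basis.algebra
  have nd: "\<not> int p dvd 3" "\<not> int p dvd a" "\<not> int p dvd N"
    using assms(4) unfolding cube by auto
  then have ndvd: "\<not> int p dvd 3 * a ^ 2 * N" "\<not> int p dvd a * N"
    using assms(2) by (auto simp: prime_dvd_mult_iff power2_eq_square)
  have p3: "p \<noteq> 3"
    using nd(1) by auto
  have nz: "rat_of_int a \<noteq> 0" "rat_of_int N \<noteq> 0"
    using nd by auto
  have luc: "a * u n = trisect 1 a n - trisect 2 a n" for n
    using assms(5-7) by (rule lucas_eq_trisect)
  note cong = trisect_prime_cong[OF assms(2), of _ a]
  show ?thesis
  proof (intro conjI impI)
    assume "[p = 1] (mod 3)"
    then have p1: "p mod 3 = 1"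
      by (simp add: cong_def)
    have "[trisect 0 a p = 1] (mod int p)" "[trisect 1 a p = a] (mod int p)"
      "[trisect 2 a p = 0] (mod int p)"
      using cong[of 0] cong[of 1] cong[of 2] p1 by simp_all
    then obtain C D E where CDE: "trisect 0 a p = 1 + int p * C" "trisect 1 a p = a + int p * D"
      "trisect 2 a p = int p * E"
      by (metis cong_iff_lin cong_sym add_0)
    have pow: "(a + 1) ^ p = a + 1 + int p * (C + D + E)"
      unfolding trisect_sum[symmetric] CDE by Groebner_Basis.algebra
    have norm: "N ^ p = norm3 (1 + int p * C) (a + int p * D) (int p * E)"
      unfolding N_def trisect_norm[symmetric] CDE ..
    obtain z where z: "p_integral p z"
      "rat_of_int (D - (1 - a) * E - a * C) / rat_of_int (a * N) =
      2 / (3 * rat_of_int a ^ 2) * (\<Sum>k = 1..p div 3. (- rat_of_int a) ^ (3 * k) / rat_of_nat k)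
      + 1 / (3 * rat_of_int a ^ 2) * (rat_of_int (2 - a) * fermat_quotient p N
                 + 2 * rat_of_int (a + 1) * fermat_quotient p (a + 1)) + rat_of_nat p * z"
      using fermat_quotients_elimination[OF assms(2) p3 N_def ndvd(1) CDE(1) pow norm] .
    \<comment> \<open>\<open>trisect_Suc\<close> only steps upwards, so \<open>u (p - 1)\<close> is
      reached by running the recurrence backwards; this puts \<open>N\<close> into the
      denominator.\<close>
    have "u (p + 1) = (2 - a) * u p - N * u (p - 1)"
      using assms(7)[of p] p0 by (simp add: N_def)
    then have "a * N * u (p - 1) = (2 - a) * (a * u p) - a * u (p + 1)"
      by Groebner_Basis.algebra
    \<comment> \<open>The terms free of \<open>p\<close> cancel.\<close>
    also have "\<dots> = int p * (D - (1 - a) * E - a * C)"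
      unfolding luc Suc_eq_plus1[symmetric] trisect_Suc CDE by Groebner_Basis.algebra
    finally have "rat_of_int (a * N * u (p - 1)) = rat_of_int (int p * (D - (1 - a) * E - a * C))"
      by (rule arg_cong)
    then have "rat_of_int (a * N) * rat_of_int (u (p - 1)) = rat_of_nat p * rat_of_int (D - (1 - a) * E - a * C)"
      by (simp only: of_int_mult of_int_of_nat_eq)
    then have eq: "rat_of_int (u (p - 1)) / rat_of_nat p = rat_of_int (D - (1 - a) * E - a * C) / rat_of_int (a * N)"
      using p0 nz by (simp add: divide_simps mult.commute)
    have "(p - 1) div 3 = p div 3"
      using p1 by presburger
    then show "rat_cong p (rat_of_int (u (p - 1)) / rat_of_nat p)
             (2 / (3 * rat_of_int a ^ 2) *
                (\<Sum>k = 1..(p - 1) div 3. (- rat_of_int a) ^ (3 * k) / rat_of_nat k)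
              + 1 / (3 * rat_of_int a ^ 2) *
                (rat_of_int (2 - a) * fermat_quotient p (a ^ 2 - a + 1)
                 + 2 * rat_of_int (a + 1) * fermat_quotient p (a + 1)))"
      unfolding N_def[symmetric] eq using z ndvd(2) assms(2)
      by (intro rat_congI[of p _ z] p_integral_divide p_integral_of_int) simp_all
  next
    assume "[p = 2] (mod 3)"
    then have p2: "p mod 3 = 2"
      by (simp add: cong_def)
    have "[trisect 0 a p = 1] (mod int p)" "[trisect 1 a p = 0] (mod int p)"
      "[trisect 2 a p = a] (mod int p)"
      using cong[of 0] cong[of 1] cong[of 2] p2 by simp_all
    \<comment> \<open>The term \<open>k = p\<close> now lies in class 2, so classes 1 and 2 are
      exchanged; symmetry of \<open>norm3\<close> keeps the elimination applicable.\<close>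
    then obtain C D E where CDE: "trisect 0 a p = 1 + int p * C" "trisect 2 a p = a + int p * D"
      "trisect 1 a p = int p * E"
      by (metis cong_iff_lin cong_sym add_0)
    have pow: "(a + 1) ^ p = a + 1 + int p * (C + D + E)"
      unfolding trisect_sum[symmetric] CDE by Groebner_Basis.algebra
    have norm: "N ^ p = norm3 (1 + int p * C) (a + int p * D) (int p * E)"
      unfolding N_def trisect_norm[symmetric] CDE norm3_def by Groebner_Basis.algebra
    obtain z where z: "p_integral p z"
      "rat_of_int (D - (1 - a) * E - a * C) / rat_of_int (a * N) =
      2 / (3 * rat_of_int a ^ 2) * (\<Sum>k = 1..p div 3. (- rat_of_int a) ^ (3 * k) / rat_of_nat k)
      + 1 / (3 * rat_of_int a ^ 2) * (rat_of_int (2 - a) * fermat_quotient p N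
                 + 2 * rat_of_int (a + 1) * fermat_quotient p (a + 1)) + rat_of_nat p * z"
      using fermat_quotients_elimination[OF assms(2) p3 N_def ndvd(1) CDE(1) pow norm] .
    \<comment> \<open>One step up from \<open>p\<close> yields the same combination with opposite
      sign and no division by \<open>N\<close>.\<close>
    have "a * u (p + 1) = - int p * (D - (1 - a) * E - a * C)"
      unfolding luc Suc_eq_plus1[symmetric] trisect_Suc CDE by Groebner_Basis.algebra
    then have "rat_of_int (a * u (p + 1)) = rat_of_int (- int p * (D - (1 - a) * E - a * C))"
      by (rule arg_cong)
    then have "rat_of_int a * rat_of_int (u (p + 1)) = - rat_of_nat p * rat_of_int (D - (1 - a) * E - a * C)"
      by (simp only: of_int_mult of_int_of_nat_eq of_int_minus)
    then have eq1: "rat_of_int (u (p + 1)) / rat_of_nat p = rat_of_int (- (D - (1 - a) * E - a * C)) / rat_of_int a"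
      using p0 nz unfolding of_int_minus by (simp add: divide_simps mult.commute)
    \<comment> \<open>Inserting \<open>N / N\<close> exposes the eliminated quotient; hence the
      factor \<open>- N\<close> on the right-hand side and on the error \<open>z\<close>.\<close>
    have eq: "rat_of_int (u (p + 1)) / rat_of_nat p = - rat_of_int N * (rat_of_int (D - (1 - a) * E - a * C) / rat_of_int (a * N))"
      unfolding eq1 of_int_minus of_int_mult[of a N] using nz by (simp add: field_simps)
    have int: "p_integral p (rat_of_int (u (p + 1)) / rat_of_nat p)"
      unfolding eq1 using assms(2) nd(2) by (intro p_integral_divide p_integral_of_int)
    have int': "p_integral p (rat_of_int (- N) * z)"
      using assms(2) z(1) by (intro p_integral_mult p_integral_of_int)
    have div: "(p - 2) div 3 = p div 3"
      using p2 by presburger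
    have distr: "- n * (2 / A * S + 1 / A * F + P * z) = - (2 * n / A) * S - n / A * F + P * (- n * z)"
      for n A S F P :: rat
      by (simp add: algebra_simps)
    show "rat_cong p (rat_of_int (u (p + 1)) / rat_of_nat p)
             (- (2 * rat_of_int (a ^ 2 - a + 1) / (3 * rat_of_int a ^ 2)) *
                (\<Sum>k = 1..(p - 2) div 3. (- rat_of_int a) ^ (3 * k) / rat_of_nat k)
              - rat_of_int (a ^ 2 - a + 1) / (3 * rat_of_int a ^ 2) *
                (rat_of_int (2 - a) * fermat_quotient p (a ^ 2 - a + 1)
                 + 2 * rat_of_int (a + 1) * fermat_quotient p (a + 1)))"
      unfolding N_def[symmetric] div
      by (rule rat_congI[OF assms(2) int int']) (unfold eq z(2) of_int_minus[of N], rule distr)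
  qed
qed

end
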